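(* Let $M$ be a connected smooth manifold and let $(F,\mathsf m,\mathsf e,\mathsf b)$ be an octonion algebra object in the category of smooth vector bundles over $M$. Then for every point $p\in M$ the data at the fibre $(F_p,\mathsf m_p,\mathsf e_p,\mathsf b_p)$ define an octonion algebra over $\mathbb R$ with underlying vector space $F_p$.
   Context: $\Lambda^0=M\times\mathbb R$ is the trivial line bundle. An octonion algebra object over $M$ is a smooth rank $8$ vector bundle $F\to M$ with vector bundle morphisms $\mathsf m:F\otimes F\to F$, $\mathsf e:\Lambda^0\to F$, $\mathsf b:F\otimes F\to\Lambda^0$ such that: (1) $\mathsf m\circ(\mathsf e\otimes\mathrm{Id})$ and $\mathsf m\circ(\mathrm{Id}\otimes\mathsf e)$ are the canonical isomorphisms $\Lambda^0\otimes F\cong F$, $F\otimes\Lambda^0\cong F$; (2) $\mathsf b$ is invariant under swapping the two factors; (3) $\mathsf b\otimes\mathsf b$ (followed by $\Lambda^0\otimes\Lambda^0\cong\Lambda^0$) equals $\mathsf b\circ(\mathsf m\otimes\mathsf m)\circ\mathsf T_{1324}+\mathsf b\circ(\mathsf m\otimes\mathsf m)\circ\mathsf T_{1423}$, where $\mathsf T_{1324}(x_1\otimes x_2\otimes x_3\otimes x_4)=x_1\otimes x_3\otimes x_2\otimes x_4$ and $\mathsf T_{1423}(x_1\otimes x_2\otimes x_3\otimes x_4)=x_1\otimes x_4\otimes x_2\otimes x_3$; (4) for each $p\in M$, $v\mapsto\mathsf b_p(v,-)$ is an isomorphism $F_p\to F_p^\vee$. An octonion algebra over $\mathbb R$ is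 an $8$-dimensional real vector space $C$ with a bilinear (not necessarily commutative or associative) multiplication with identity element and a quadratic form $q$ whose bilinear form $b(x,y)=q(x+y)-q(x)-q(y)$ is non-degenerate and which satisfies $q(xy)=q(x)q(y)$. Here $q(x)=\frac12\mathsf b_p(x,x)$ and the identity is $\mathsf e_p(1)$. *)

theory Defs
  imports "HOL-Analysis.Analysis"
begin

section \<open>Linear algebra on subspaces\<close>

definition linear_on :: "'a::real_vector set \<Rightarrow> ('a \<Rightarrow> 'b::real_vector) \<Rightarrow> bool" where
  "linear_on V f \<longleftrightarrow> (\<forall>x\<in>V. \<forall>y\<in>V. f (x + y) = f x + f y) \<and> (\<forall>c. \<forall>x\<in>V. f (c *\<^sub>R x) = c *\<^sub>R f x)"

definition bilinear_on ::
  "'a::real_vector set \<Rightarrow> 'b::real_vector set \<Rightarrow> ('a \<Rightarrow> 'b \<Rightarrow> 'c::real_vector) \<Rightarrow> bool" where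
  "bilinear_on V W f \<longleftrightarrow> (\<forall>x\<in>V. linear_on W (f x)) \<and> (\<forall>y\<in>W. linear_on V (\<lambda>x. f x y))"

lemma bilinear_on_UNIV: "bilinear_on UNIV UNIV f \<longleftrightarrow> bilinear f"
  by (auto simp: bilinear_on_def bilinear_def linear_on_def linear_iff)

text \<open>Functions in the dual are normalised to be \<^const>\<open>undefined\<close> outside \<open>V\<close>, so that distinct
  elements of this set are distinct linear forms on \<open>V\<close>.\<close>

definition dual_space :: "'a::real_vector set \<Rightarrow> ('a \<Rightarrow> real) set" where
  "dual_space V = {f \<in> extensional V. linear_on V f}"


section \<open>Tensor products of real vector spaces\<close>

text \<open>Since bilinear forms separate the elements of the algebraic tensor product of real vector
  spaces, the latter embeds into the functionals on bilinear forms, \<open>x \<otimes> y\<close> being evaluation at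
  \<open>(x, y)\<close>; the tensor product is the set of finite sums of such evaluations. Nothing below depends
  on this model: the universal property is proved in \<open>tensor_universal\<close>.\<close>

definition eval_bilinear ::
  "('a::real_vector \<times> 'b::real_vector) list \<Rightarrow> ('a \<Rightarrow> 'b \<Rightarrow> real) \<Rightarrow> real" where
  "eval_bilinear xs \<beta> = (if bilinear \<beta> then \<Sum>(x, y)\<leftarrow>xs. \<beta> x y else 0)"

typedef (overloaded) ('a, 'b) tensor =
  "range (eval_bilinear :: ('a::real_vector \<times> 'b::real_vector) list \<Rightarrow> ('a \<Rightarrow> 'b \<Rightarrow> real) \<Rightarrow> real)"
  by blast

definition tensor :: "'a::real_vector \<Rightarrow> 'b::real_vector \<Rightarrow> ('a, 'b) tensor" (infixl \<open>\<otimes>\<close> 76) where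
  "x \<otimes> y = Abs_tensor (eval_bilinear [(x, y)])"

lemma eval_bilinear_append:
  "eval_bilinear (xs @ ys) = (\<lambda>\<beta>. eval_bilinear xs \<beta> + eval_bilinear ys \<beta>)"
  by (auto simp: eval_bilinear_def)

lemma eval_bilinear_scale:
  "eval_bilinear (map (\<lambda>(x, y). (c *\<^sub>R x, y)) xs) = (\<lambda>\<beta>. c * eval_bilinear xs \<beta>)"
proof
  fix \<beta> :: "'a \<Rightarrow> 'b \<Rightarrow> real"
  show "eval_bilinear (map (\<lambda>(x, y). (c *\<^sub>R x, y)) xs) \<beta> = c * eval_bilinear xs \<beta>"
  proof (cases "bilinear \<beta>")
    case True
    then show ?thesis
      by (induction xs) (auto simp: eval_bilinear_def bilinear_lmul algebra_simps)
  qed (simp add: eval_bilinear_def)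
qed

lemma Rep_tensor_add_closed:
  "(\<lambda>\<beta>. Rep_tensor s \<beta> + Rep_tensor t \<beta>) \<in> range eval_bilinear"
proof -
  obtain xs ys where "Rep_tensor s = eval_bilinear xs" "Rep_tensor t = eval_bilinear ys"
    using Rep_tensor[of s] Rep_tensor[of t] by blast
  then show ?thesis
    by (simp add: eval_bilinear_append[symmetric])
qed

lemma Rep_tensor_scale_closed:
  "(\<lambda>\<beta>. c * Rep_tensor t \<beta>) \<in> range eval_bilinear"
proof -
  obtain xs where "Rep_tensor t = eval_bilinear xs"
    using Rep_tensor[of t] by blast
  then show ?thesis
    by (simp add: eval_bilinear_scale[symmetric])
qed

instantiation tensor :: (real_vector, real_vector) real_vector
begin

definition zero_tensor :: "('a, 'b) tensor" where
  "zero_tensor = Abs_tensor (\<lambda>\<beta>. 0)"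

definition plus_tensor :: "('a, 'b) tensor \<Rightarrow> ('a, 'b) tensor \<Rightarrow> ('a, 'b) tensor" where
  "plus_tensor s t = Abs_tensor (\<lambda>\<beta>. Rep_tensor s \<beta> + Rep_tensor t \<beta>)"

definition scaleR_tensor :: "real \<Rightarrow> ('a, 'b) tensor \<Rightarrow> ('a, 'b) tensor" where
  "scaleR_tensor c t = Abs_tensor (\<lambda>\<beta>. c * Rep_tensor t \<beta>)"

definition uminus_tensor :: "('a, 'b) tensor \<Rightarrow> ('a, 'b) tensor" where
  "uminus_tensor t = (- 1) *\<^sub>R t"

definition minus_tensor :: "('a, 'b) tensor \<Rightarrow> ('a, 'b) tensor \<Rightarrow> ('a, 'b) tensor" where
  "minus_tensor s t = s + (- 1) *\<^sub>R t"

lemma Rep_tensor_zero: "Rep_tensor (0 :: ('a, 'b) tensor) = (\<lambda>\<beta>. 0)"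
proof -
  have "eval_bilinear [] = (\<lambda>\<beta> :: 'a \<Rightarrow> 'b \<Rightarrow> real. 0)"
    by (auto simp: eval_bilinear_def)
  then have "(\<lambda>\<beta> :: 'a \<Rightarrow> 'b \<Rightarrow> real. 0) \<in> range eval_bilinear"
    by (metis rangeI)
  then show ?thesis
    by (simp add: zero_tensor_def Abs_tensor_inverse)
qed

lemma Rep_tensor_plus:
  "Rep_tensor (s + t :: ('a, 'b) tensor) = (\<lambda>\<beta>. Rep_tensor s \<beta> + Rep_tensor t \<beta>)"
  by (simp add: plus_tensor_def Abs_tensor_inverse Rep_tensor_add_closed)

lemma Rep_tensor_scaleR:
  "Rep_tensor (c *\<^sub>R t :: ('a, 'b) tensor) = (\<lambda>\<beta>. c * Rep_tensor t \<beta>)"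
  by (simp add: scaleR_tensor_def Abs_tensor_inverse Rep_tensor_scale_closed)

instance
  by intro_classes
    (auto simp: Rep_tensor_inject[symmetric] Rep_tensor_zero Rep_tensor_plus Rep_tensor_scaleR
        uminus_tensor_def minus_tensor_def algebra_simps)

end

lemma Rep_tensor_tensor: "Rep_tensor (x \<otimes> y) = (\<lambda>\<beta>. if bilinear \<beta> then \<beta> x y else 0)"
  by (auto simp: tensor_def Abs_tensor_inverse eval_bilinear_def)

lemma bilinear_tensor: "bilinear (\<otimes>)"
  by (auto simp: bilinear_def linear_iff Rep_tensor_inject[symmetric] Rep_tensor_plus
      Rep_tensor_scaleR Rep_tensor_tensor)

lemma tensor_add:
  "(x + x') \<otimes> y = x \<otimes> y + x' \<otimes> y" "x \<otimes> (y + y') = x \<otimes> y + x \<otimes> y'"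
  by (rule bilinear_ladd[OF bilinear_tensor] bilinear_radd[OF bilinear_tensor])+

lemma tensor_scale:
  "(c *\<^sub>R x) \<otimes> y = c *\<^sub>R (x \<otimes> y)" "x \<otimes> (c *\<^sub>R y) = c *\<^sub>R (x \<otimes> y)"
  by (rule bilinear_lmul[OF bilinear_tensor] bilinear_rmul[OF bilinear_tensor])+

lemma Rep_tensor_sum_list:
  "Rep_tensor (\<Sum>(x, y)\<leftarrow>xs. x \<otimes> y) = eval_bilinear xs"
proof (induction xs)
  case Nil
  then show ?case by (auto simp: Rep_tensor_zero eval_bilinear_def)
next
  case (Cons p xs)
  then show ?case
    using eval_bilinear_append[of "[p]" xs]
    by (cases p) (auto simp: Rep_tensor_plus Rep_tensor_tensor eval_bilinear_def)
qed

lemma tensor_sum_listE: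
  obtains xs where "t = (\<Sum>(x, y)\<leftarrow>xs. x \<otimes> y)"
proof -
  obtain xs where "Rep_tensor t = eval_bilinear xs"
    using Rep_tensor[of t] by blast
  then have "t = (\<Sum>(x, y)\<leftarrow>xs. x \<otimes> y)"
    by (simp add: Rep_tensor_inject[symmetric] Rep_tensor_sum_list)
  then show thesis
    by (rule that)
qed

lemma linear_sum_list:
  "linear L \<Longrightarrow> L (\<Sum>(x, y)\<leftarrow>xs. g x y) = (\<Sum>(x, y)\<leftarrow>xs. L (g x y))"
  by (induction xs) (auto simp: linear_0 linear_add)

lemma linear_tensor_eq:
  assumes "linear L" "linear M" "\<And>x y. L (x \<otimes> y) = M (x \<otimes> y)"
  shows "L t = M t"
proof -
  obtain xs where t: "t = (\<Sum>(x, y)\<leftarrow>xs. x \<otimes> y)"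
    using tensor_sum_listE by blast
  show ?thesis
    unfolding t linear_sum_list[OF assms(1)] linear_sum_list[OF assms(2)] assms(3) ..
qed

theorem tensor_universal:
  fixes f :: "'a::real_vector \<Rightarrow> 'b::real_vector \<Rightarrow> 'c::real_vector"
  assumes f: "bilinear f"
  shows "\<exists>!L. linear L \<and> (\<forall>x y. L (x \<otimes> y) = f x y)"
proof -
  have wd: "(\<Sum>(x, y)\<leftarrow>xs. f x y) = (\<Sum>(x, y)\<leftarrow>ys. f x y)"
    if eq: "(\<Sum>(x, y)\<leftarrow>xs. x \<otimes> y) = (\<Sum>(x, y)\<leftarrow>ys. x \<otimes> y)" for xs ys
  proof (rule ccontr)
    let ?d = "(\<Sum>(x, y)\<leftarrow>xs. f x y) - (\<Sum>(x, y)\<leftarrow>ys. f x y)"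
    assume "(\<Sum>(x, y)\<leftarrow>xs. f x y) \<noteq> (\<Sum>(x, y)\<leftarrow>ys. f x y)"
    then have "independent {?d}"
      by simp
    then obtain g :: "'c \<Rightarrow> real" where g: "linear g" "g ?d = 1"
      using linear_independent_extend[of "{?d}" "\<lambda>_. 1 :: real"] by auto
    have "bilinear (\<lambda>x y. g (f x y))"
      using f g(1) by (auto simp: bilinear_def intro: linear_compose[unfolded o_def])
    moreover have "eval_bilinear xs = eval_bilinear ys"
      using eq Rep_tensor_sum_list by metis
    ultimately have "(\<Sum>(x, y)\<leftarrow>xs. g (f x y)) = (\<Sum>(x, y)\<leftarrow>ys. g (f x y))"
      unfolding eval_bilinear_def by meson
    then have "g ?d = 0"
      by (simp add: linear_diff[OF g(1)] linear_sum_list[OF g(1)])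
    with g(2) show False
      by simp
  qed
  define rep :: "('a, 'b) tensor \<Rightarrow> ('a \<times> 'b) list" where "rep = (\<lambda>t. SOME xs. t = (\<Sum>(x, y)\<leftarrow>xs. x \<otimes> y))"
  define L where "L = (\<lambda>t. \<Sum>(x, y)\<leftarrow>rep t. f x y)"
  have rep: "t = (\<Sum>(x, y)\<leftarrow>rep t. x \<otimes> y)" for t
    unfolding rep_def by (rule someI_ex) (meson tensor_sum_listE)
  have L: "L (\<Sum>(x, y)\<leftarrow>xs. x \<otimes> y) = (\<Sum>(x, y)\<leftarrow>xs. f x y)" for xs
    unfolding L_def by (rule wd) (rule rep[symmetric])
  have scale: "(\<Sum>(x, y)\<leftarrow>map (\<lambda>(x, y). (c *\<^sub>R x, y)) xs. h x y) = c *\<^sub>R (\<Sum>(x, y)\<leftarrow>xs. h x y)"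
    if "bilinear h" for c xs and h :: "'a \<Rightarrow> 'b \<Rightarrow> 'd::real_vector"
    using that by (induction xs) (auto simp: bilinear_lmul scaleR_add_right)
  have "linear L"
  proof (rule linearI)
    fix s t :: "('a, 'b) tensor"
    have "s + t = (\<Sum>(x, y)\<leftarrow>rep s @ rep t. x \<otimes> y)"
      using rep[of s] rep[of t] by simp
    then have "L (s + t) = (\<Sum>(x, y)\<leftarrow>rep s @ rep t. f x y)"
      using L by metis
    then show "L (s + t) = L s + L t"
      by (simp add: L_def)
  next
    fix c :: real and t :: "('a, 'b) tensor"
    have "c *\<^sub>R t = (\<Sum>(x, y)\<leftarrow>map (\<lambda>(x, y). (c *\<^sub>R x, y)) (rep t). x \<otimes> y)"
      using rep[of t] by (simp only: scale[OF bilinear_tensor])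
    then have "L (c *\<^sub>R t) = (\<Sum>(x, y)\<leftarrow>map (\<lambda>(x, y). (c *\<^sub>R x, y)) (rep t). f x y)"
      using L by metis
    then show "L (c *\<^sub>R t) = c *\<^sub>R L t"
      by (simp only: scale[OF f] L_def)
  qed
  moreover have "L (x \<otimes> y) = f x y" for x y
    using L[of "[(x, y)]"] by simp
  moreover have "M = L" if M: "linear M" "\<forall>x y. M (x \<otimes> y) = f x y" for M
  proof
    fix t
    show "M t = L t"
      using rep[of t] linear_sum_list[OF M(1), of "(\<otimes>)" "rep t"] M(2) by (simp add: L_def)
  qed
  ultimately show ?thesis
    by blast
qed

text \<open>\<open>V \<otimes> W\<close>, for subspaces \<open>V\<close> and \<open>W\<close> of the two factors.\<close>

definition tensor_space :: "'a::real_vector set \<Rightarrow> 'b::real_vector set \<Rightarrow> ('a, 'b) tensor set" where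
  "tensor_space V W = span {x \<otimes> y | x y. x \<in> V \<and> y \<in> W}"

text \<open>The linear map on \<open>V \<otimes> W\<close> induced by a bilinear map on \<open>V \<times> W\<close>; only its values on
  \<open>tensor_space V W\<close> are meaningful.\<close>

definition tensor_lift ::
  "'a::real_vector set \<Rightarrow> 'b::real_vector set \<Rightarrow> ('a \<Rightarrow> 'b \<Rightarrow> 'c::real_vector) \<Rightarrow> ('a, 'b) tensor \<Rightarrow> 'c" where
  "tensor_lift V W f = (SOME L. linear L \<and> (\<forall>x\<in>V. \<forall>y\<in>W. L (x \<otimes> y) = f x y))"

lemma subspace_projection:
  fixes V :: "'a::real_vector set"
  assumes "subspace V"
  obtains P where "linear P" "range P \<subseteq> V" "\<And>x. x \<in> V \<Longrightarrow> P x = x"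
  using linear_exists_left_inverse_on[OF linear_id assms] by auto

lemma tensor_lift:
  fixes f :: "'a::real_vector \<Rightarrow> 'b::real_vector \<Rightarrow> 'c::real_vector"
  assumes V: "subspace V" and W: "subspace W" and f: "bilinear_on V W f"
  shows linear_tensor_lift: "linear (tensor_lift V W f)"
    and tensor_lift_tensor: "\<And>x y. x \<in> V \<Longrightarrow> y \<in> W \<Longrightarrow> tensor_lift V W f (x \<otimes> y) = f x y"
proof -
  obtain P where P: "linear P" "range P \<subseteq> V" "\<And>x. x \<in> V \<Longrightarrow> P x = x"
    using subspace_projection[OF V] by blast
  obtain Q where Q: "linear Q" "range Q \<subseteq> W" "\<And>x. x \<in> W \<Longrightarrow> Q x = x"
    using subspace_projection[OF W] by blast
  have PQ: "P x \<in> V" "Q y \<in> W" for x y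
    using P(2) Q(2) by auto
  have "bilinear (\<lambda>x y. f (P x) (Q y))"
    using f PQ by (auto simp: bilinear_def bilinear_on_def linear_on_def linear_iff
        linear_add[OF P(1)] linear_add[OF Q(1)] linear_scale[OF P(1)] linear_scale[OF Q(1)])
  then obtain L where "linear L" "\<forall>x y. L (x \<otimes> y) = f (P x) (Q y)"
    using tensor_universal by blast
  then have "\<exists>L. linear L \<and> (\<forall>x\<in>V. \<forall>y\<in>W. L (x \<otimes> y) = f x y)"
    using P(3) Q(3) by auto
  from someI_ex[OF this] show "linear (tensor_lift V W f)"
    and "\<And>x y. x \<in> V \<Longrightarrow> y \<in> W \<Longrightarrow> tensor_lift V W f (x \<otimes> y) = f x y"
    unfolding tensor_lift_def by auto
qed

definition tensor_map ::
  "'a::real_vector set \<Rightarrow> 'b::real_vector set \<Rightarrow> ('a \<Rightarrow> 'c::real_vector) \<Rightarrow> ('b \<Rightarrow> 'd::real_vector)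
    \<Rightarrow> ('a, 'b) tensor \<Rightarrow> ('c, 'd) tensor" where
  "tensor_map V W f g = tensor_lift V W (\<lambda>x y. f x \<otimes> g y)"

definition tensor_swap :: "('a::real_vector, 'b::real_vector) tensor \<Rightarrow> ('b, 'a) tensor" where
  "tensor_swap = tensor_lift UNIV UNIV (\<lambda>x y. y \<otimes> x)"

text \<open>The canonical isomorphisms \<open>\<real> \<otimes> V \<cong> V\<close> and \<open>V \<otimes> \<real> \<cong> V\<close>.\<close>

definition tensor_lunit :: "(real, 'a::real_vector) tensor \<Rightarrow> 'a" where
  "tensor_lunit = tensor_lift UNIV UNIV (\<lambda>c x. c *\<^sub>R x)"

definition tensor_runit :: "('a::real_vector, real) tensor \<Rightarrow> 'a" where
  "tensor_runit = tensor_lift UNIV UNIV (\<lambda>x c. c *\<^sub>R x)"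

lemma tensor_swap_tensor: "tensor_swap (x \<otimes> y) = y \<otimes> x"
  unfolding tensor_swap_def
  by (subst tensor_lift_tensor) (auto simp: bilinear_on_def linear_on_def tensor_add tensor_scale)

lemma tensor_lunit_tensor: "tensor_lunit (c \<otimes> x) = c *\<^sub>R x"
  unfolding tensor_lunit_def
  by (subst tensor_lift_tensor) (auto simp: bilinear_on_def linear_on_def algebra_simps)

lemma tensor_runit_tensor: "tensor_runit (x \<otimes> c) = c *\<^sub>R x"
  unfolding tensor_runit_def
  by (subst tensor_lift_tensor) (auto simp: bilinear_on_def linear_on_def algebra_simps)

lemma quadrilinear_universal:
  fixes f :: "'a::real_vector \<Rightarrow> 'b::real_vector \<Rightarrow> 'c::real_vector \<Rightarrow> 'd::real_vector \<Rightarrow> 'e::real_vector"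
  assumes 1: "\<And>x2 x3 x4. linear (\<lambda>x1. f x1 x2 x3 x4)" and 2: "\<And>x1 x3 x4. linear (\<lambda>x2. f x1 x2 x3 x4)"
    and 3: "\<And>x1 x2 x4. linear (\<lambda>x3. f x1 x2 x3 x4)" and 4: "\<And>x1 x2 x3. linear (f x1 x2 x3)"
  shows "\<exists>!T. linear T \<and> (\<forall>x1 x2 x3 x4. T ((x1 \<otimes> x2) \<otimes> (x3 \<otimes> x4)) = f x1 x2 x3 x4)"
proof -
  define G where "G = (\<lambda>x1 x2. tensor_lift UNIV UNIV (f x1 x2))"
  have G: "linear (G x1 x2)" "G x1 x2 (x3 \<otimes> x4) = f x1 x2 x3 x4" for x1 x2 x3 x4
    using tensor_lift[OF subspace_UNIV subspace_UNIV, of "f x1 x2"] 3 4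
    by (auto simp: G_def bilinear_on_UNIV bilinear_def)
  note lin = linear_compose_add linear_compose_scale_right G(1)
  have Gt: "bilinear (\<lambda>x1 x2. G x1 x2 t)" for t
    unfolding bilinear_def
  proof (intro conjI allI linearI)
    fix x y z c
    show "G x (y + z) t = G x y t + G x z t"
      by (rule linear_tensor_eq[of "G x (y + z)" "\<lambda>t. G x y t + G x z t"])
        (intro lin, intro lin, simp add: G(2) linear_add[OF 2])
    show "G x (c *\<^sub>R y) t = c *\<^sub>R G x y t"
      by (rule linear_tensor_eq[of "G x (c *\<^sub>R y)" "\<lambda>t. c *\<^sub>R G x y t"])
        (intro lin, intro lin, simp add: G(2) linear_scale[OF 2])
  next
    fix x y z c
    show "G (y + z) x t = G y x t + G z x t"
      by (rule linear_tensor_eq[of "G (y + z) x" "\<lambda>t. G y x t + G z x t"])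
        (intro lin, intro lin, simp add: G(2) linear_add[OF 1])
    show "G (c *\<^sub>R y) x t = c *\<^sub>R G y x t"
      by (rule linear_tensor_eq[of "G (c *\<^sub>R y) x" "\<lambda>t. c *\<^sub>R G y x t"])
        (intro lin, intro lin, simp add: G(2) linear_scale[OF 1])
  qed
  define H where "H = (\<lambda>s t. tensor_lift UNIV UNIV (\<lambda>x1 x2. G x1 x2 t) s)"
  have H: "linear (\<lambda>s. H s t)" "H (x1 \<otimes> x2) t = G x1 x2 t" for x1 x2 t
    using tensor_lift[OF subspace_UNIV subspace_UNIV, of "\<lambda>x1 x2. G x1 x2 t"] Gt[of t]
    by (auto simp: H_def bilinear_on_UNIV)
  have "bilinear H"
    unfolding bilinear_def
  proof (intro conjI allI H(1) linearI)
    fix s t u c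
    show "H s (t + u) = H s t + H s u"
      by (rule linear_tensor_eq[of "\<lambda>s. H s (t + u)" "\<lambda>s. H s t + H s u"])
        (intro H(1), intro linear_compose_add H(1), simp add: H(2) linear_add[OF G(1)])
    show "H s (c *\<^sub>R t) = c *\<^sub>R H s t"
      by (rule linear_tensor_eq[of "\<lambda>s. H s (c *\<^sub>R t)" "\<lambda>s. c *\<^sub>R H s t"])
        (intro H(1), intro linear_compose_scale_right H(1), simp add: H(2) linear_scale[OF G(1)])
  qed
  then obtain T where T: "linear T" "\<And>s t. T (s \<otimes> t) = H s t"
    using tensor_universal by blast
  show ?thesis
  proof (rule ex1I[of _ T])
    show "linear T \<and> (\<forall>x1 x2 x3 x4. T ((x1 \<otimes> x2) \<otimes> (x3 \<otimes> x4)) = f x1 x2 x3 x4)"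
      by (simp add: T H G)
  next
    fix T' assume T': "linear T' \<and> (\<forall>x1 x2 x3 x4. T' ((x1 \<otimes> x2) \<otimes> (x3 \<otimes> x4)) = f x1 x2 x3 x4)"
    have lin': "linear (\<lambda>t. T' (s \<otimes> t))" "linear (\<lambda>s. T' (s \<otimes> t))" for s t
      by (simp_all add: linear_iff tensor_add tensor_scale linear_add[OF conjunct1[OF T']]
          linear_scale[OF conjunct1[OF T']])
    have "T' ((x1 \<otimes> x2) \<otimes> t) = G x1 x2 t" for x1 x2 t
      by (rule linear_tensor_eq[of "\<lambda>t. T' ((x1 \<otimes> x2) \<otimes> t)" "G x1 x2"]) (use T' in \<open>simp_all add: lin' G\<close>)
    note TG = this
    have "T' (s \<otimes> t) = H s t" for s t
      by (rule linear_tensor_eq[of "\<lambda>s. T' (s \<otimes> t)" "\<lambda>s. H s t"]) (simp_all add: lin' H TG)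
    then show "T' = T"
      using linear_tensor_eq[OF conjunct1[OF T'] T(1)] by (auto simp: T(2))
  qed
qed

text \<open>Permutations of a fourfold tensor product, bracketed as \<open>(V \<otimes> V) \<otimes> (V \<otimes> V)\<close>.\<close>

definition tensor_1324 ::
  "(('a::real_vector, 'a) tensor, ('a, 'a) tensor) tensor \<Rightarrow> (('a, 'a) tensor, ('a, 'a) tensor) tensor" where
  "tensor_1324 = (THE T. linear T \<and>
     (\<forall>x1 x2 x3 x4. T ((x1 \<otimes> x2) \<otimes> (x3 \<otimes> x4)) = (x1 \<otimes> x3) \<otimes> (x2 \<otimes> x4)))"

definition tensor_1423 ::
  "(('a::real_vector, 'a) tensor, ('a, 'a) tensor) tensor \<Rightarrow> (('a, 'a) tensor, ('a, 'a) tensor) tensor" where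
  "tensor_1423 = (THE T. linear T \<and>
     (\<forall>x1 x2 x3 x4. T ((x1 \<otimes> x2) \<otimes> (x3 \<otimes> x4)) = (x1 \<otimes> x4) \<otimes> (x2 \<otimes> x3)))"

lemma tensor_1324:
  "linear (tensor_1324 :: (('a::real_vector, 'a) tensor, ('a, 'a) tensor) tensor \<Rightarrow> _) \<and> (\<forall>x1 x2 x3 x4 :: 'a.
     tensor_1324 ((x1 \<otimes> x2) \<otimes> (x3 \<otimes> x4)) = (x1 \<otimes> x3) \<otimes> (x2 \<otimes> x4))"
proof -
  have "\<exists>!T. linear T \<and> (\<forall>x1 x2 x3 x4 :: 'a. T ((x1 \<otimes> x2) \<otimes> (x3 \<otimes> x4)) = (x1 \<otimes> x3) \<otimes> (x2 \<otimes> x4))"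
    by (rule quadrilinear_universal) (simp_all add: linear_iff tensor_add tensor_scale)
  from theI'[OF this] show ?thesis
    by (simp only: tensor_1324_def)
qed

lemma tensor_1423:
  "linear (tensor_1423 :: (('a::real_vector, 'a) tensor, ('a, 'a) tensor) tensor \<Rightarrow> _) \<and> (\<forall>x1 x2 x3 x4 :: 'a.
     tensor_1423 ((x1 \<otimes> x2) \<otimes> (x3 \<otimes> x4)) = (x1 \<otimes> x4) \<otimes> (x2 \<otimes> x3))"
proof -
  have "\<exists>!T. linear T \<and> (\<forall>x1 x2 x3 x4 :: 'a. T ((x1 \<otimes> x2) \<otimes> (x3 \<otimes> x4)) = (x1 \<otimes> x4) \<otimes> (x2 \<otimes> x3))"
    by (rule quadrilinear_universal) (simp_all add: linear_iff tensor_add tensor_scale)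
  from theI'[OF this] show ?thesis
    by (simp only: tensor_1423_def)
qed

section \<open>Smooth manifolds\<close>

text \<open>\<open>\<real>\<^sup>n\<close> is the library's \<^term>\<open>Euclidean_space n\<close>, the space of \<open>x :: nat \<Rightarrow> real\<close> with \<open>x i = 0\<close>
  for \<open>i \<ge> n\<close>; thus the dimension is a natural number and may be zero.\<close>

definition partial_deriv :: "nat \<Rightarrow> ((nat \<Rightarrow> real) \<Rightarrow> real) \<Rightarrow> (nat \<Rightarrow> real) \<Rightarrow> real" where
  "partial_deriv i f x = deriv (\<lambda>t. f (x(i := t))) (x i)"

text \<open>\<open>C\<^sup>\<infinity>\<close> functions on an open subset of \<open>\<real>\<^sup>n\<close>: the iterated partial derivatives of all orders
  (including order zero) exist and are continuous.\<close>

definition smooth_on :: "nat \<Rightarrow> (nat \<Rightarrow> real) set \<Rightarrow> ((nat \<Rightarrow> real) \<Rightarrow> real) \<Rightarrow> bool" where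
  "smooth_on n U f \<longleftrightarrow> openin (Euclidean_space n) U \<and>
     (\<forall>is. set is \<subseteq> {..<n} \<longrightarrow>
        continuous_map (subtopology (Euclidean_space n) U) euclideanreal (foldr partial_deriv is f) \<and>
        (\<forall>x\<in>U. \<forall>i<n. (\<lambda>t. foldr partial_deriv is f (x(i := t))) field_differentiable at (x i)))"

text \<open>The smooth structure is given by an atlas, not required to be maximal.\<close>

record 'm manifold =
  mtop :: "'m topology"
  mdim :: nat
  charts :: "('m set \<times> ('m \<Rightarrow> nat \<Rightarrow> real)) set"

definition smooth_manifold :: "'m manifold \<Rightarrow> bool" where
  "smooth_manifold M \<longleftrightarrow>
     Hausdorff_space (mtop M) \<and> second_countable (mtop M) \<and>
     (\<Union>(U, \<phi>)\<in>charts M. U) = topspace (mtop M) \<and>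
     (\<forall>(U, \<phi>)\<in>charts M. openin (mtop M) U \<and> openin (Euclidean_space (mdim M)) (\<phi> ` U) \<and>
        homeomorphic_map (subtopology (mtop M) U) (subtopology (Euclidean_space (mdim M)) (\<phi> ` U)) \<phi>) \<and>
     (\<forall>(U, \<phi>)\<in>charts M. \<forall>(V, \<psi>)\<in>charts M. \<forall>i<mdim M.
        smooth_on (mdim M) (\<phi> ` (U \<inter> V)) (\<lambda>x. \<psi> (inv_into U \<phi> x) i))"

definition smooth_fun_on :: "'m manifold \<Rightarrow> 'm set \<Rightarrow> ('m \<Rightarrow> real) \<Rightarrow> bool" where
  "smooth_fun_on M W f \<longleftrightarrow> openin (mtop M) W \<and>
     (\<forall>(U, \<phi>)\<in>charts M. smooth_on (mdim M) (\<phi> ` (U \<inter> W)) (f \<circ> inv_into U \<phi>))"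


section \<open>Smooth vector bundles\<close>

text \<open>A vector bundle of rank \<open>CARD('r)\<close> with fibres \<open>fibre E p\<close>, which are subspaces of a common real
  vector space \<open>'v\<close> (every family of vector spaces is isomorphic to one of this form; no continuity
  in \<open>p\<close> with respect to \<open>'v\<close> is implied). The total space is the disjoint union \<open>Sigma M (fibre E)\<close>;
  its topology and smooth structure are those for which the local trivialisations
  \<open>(p, v) \<mapsto> (p, \<Phi> p v)\<close>, with \<open>(U, \<Phi>) \<in> trivs E\<close>, are diffeomorphisms onto \<open>U \<times> \<real>\<^sup>r\<close>. It is well
  defined because the transition functions are smooth.\<close>

record ('m, 'v, 'r) vbundle =
  fibre :: "'m \<Rightarrow> 'v set"
  trivs :: "('m set \<times> ('m \<Rightarrow> 'v \<Rightarrow> real ^ 'r)) set"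

text \<open>A family of linear maps between fibres, read in local trivialisations of the two bundles, has
  smooth matrix entries; for linear maps this is smoothness of the map of total spaces.\<close>

definition smooth_family ::
  "'m manifold \<Rightarrow> ('m, 'v::real_vector, 'r::finite) vbundle \<Rightarrow> ('m, 'w::real_vector, 's::finite) vbundle
    \<Rightarrow> ('m \<Rightarrow> 'v \<Rightarrow> 'w) \<Rightarrow> bool" where
  "smooth_family M E F f \<longleftrightarrow>
     (\<forall>(U, \<Phi>)\<in>trivs E. \<forall>(V, \<Psi>)\<in>trivs F. \<forall>i j.
        smooth_fun_on M (U \<inter> V) (\<lambda>p. \<Psi> p (f p (inv_into (fibre E p) (\<Phi> p) (axis j 1))) $ i))"

definition smooth_vector_bundle :: "'m manifold \<Rightarrow> ('m, 'v::real_vector, 'r::finite) vbundle \<Rightarrow> bool" where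
  "smooth_vector_bundle M E \<longleftrightarrow>
     (\<forall>p\<in>topspace (mtop M). subspace (fibre E p)) \<and>
     (\<Union>(U, \<Phi>)\<in>trivs E. U) = topspace (mtop M) \<and>
     (\<forall>(U, \<Phi>)\<in>trivs E. openin (mtop M) U \<and>
        (\<forall>p\<in>U. linear_on (fibre E p) (\<Phi> p) \<and> bij_betw (\<Phi> p) (fibre E p) UNIV)) \<and>
     smooth_family M E E (\<lambda>p v. v)"

text \<open>Morphisms of vector bundles over the identity of \<open>M\<close>.\<close>

definition bundle_morphism ::
  "'m manifold \<Rightarrow> ('m, 'v::real_vector, 'r::finite) vbundle \<Rightarrow> ('m, 'w::real_vector, 's::finite) vbundle
    \<Rightarrow> ('m \<Rightarrow> 'v \<Rightarrow> 'w) \<Rightarrow> bool" where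
  "bundle_morphism M E F f \<longleftrightarrow>
     (\<forall>p\<in>topspace (mtop M). f p \<in> fibre E p \<rightarrow> fibre F p \<and> linear_on (fibre E p) (f p)) \<and>
     smooth_family M E F f"

definition trivial_line_bundle :: "'m manifold \<Rightarrow> ('m, real, 1) vbundle" where
  "trivial_line_bundle M = \<lparr>fibre = \<lambda>p. UNIV, trivs = {(topspace (mtop M), \<lambda>p c. vec c)}\<rparr>"

text \<open>\<open>E \<otimes> F\<close>, trivialised by the tensor products of local trivialisations of \<open>E\<close> and \<open>F\<close> under the
  identification \<open>\<real>\<^sup>r \<otimes> \<real>\<^sup>s \<cong> \<real>\<^bsup>r\<times>s\<^esup>\<close>.\<close>

definition tensor_bundle ::
  "('m, 'v::real_vector, 'r::finite) vbundle \<Rightarrow> ('m, 'w::real_vector, 's::finite) vbundle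
    \<Rightarrow> ('m, ('v, 'w) tensor, 'r \<times> 's) vbundle" where
  "tensor_bundle E F = \<lparr>
     fibre = \<lambda>p. tensor_space (fibre E p) (fibre F p),
     trivs = {(U \<inter> V, \<lambda>p. tensor_lift (fibre E p) (fibre F p)
                (\<lambda>v w. \<chi> ij. \<Phi> p v $ fst ij * \<Psi> p w $ snd ij)) | U \<Phi> V \<Psi>.
              (U, \<Phi>) \<in> trivs E \<and> (V, \<Psi>) \<in> trivs F}\<rparr>"


section \<open>Octonion algebras and octonion algebra objects\<close>

definition octonion_algebra_object ::
  "'m manifold \<Rightarrow> ('m, 'v::real_vector, 8) vbundle
    \<Rightarrow> ('m \<Rightarrow> ('v, 'v) tensor \<Rightarrow> 'v) \<Rightarrow> ('m \<Rightarrow> real \<Rightarrow> 'v) \<Rightarrow> ('m \<Rightarrow> ('v, 'v) tensor \<Rightarrow> real) \<Rightarrow> bool" where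
  "octonion_algebra_object M F m e b \<longleftrightarrow>
     (let L = trivial_line_bundle M; FF = tensor_bundle F F in
       smooth_vector_bundle M F \<and>
       bundle_morphism M FF F m \<and> bundle_morphism M L F e \<and> bundle_morphism M FF L b \<and>
       (\<forall>p\<in>topspace (mtop M).
          (\<forall>t\<in>fibre (tensor_bundle L F) p. m p (tensor_map (fibre L p) (fibre F p) (e p) id t) = tensor_lunit t) \<and>
          (\<forall>t\<in>fibre (tensor_bundle F L) p. m p (tensor_map (fibre F p) (fibre L p) id (e p) t) = tensor_runit t) \<and>
          (\<forall>t\<in>fibre FF p. b p (tensor_swap t) = b p t) \<and>
          (\<forall>t\<in>fibre (tensor_bundle FF FF) p.
             tensor_lunit (tensor_map (fibre FF p) (fibre FF p) (b p) (b p) t) =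
               b p (tensor_map (fibre FF p) (fibre FF p) (m p) (m p) (tensor_1324 t)) +
               b p (tensor_map (fibre FF p) (fibre FF p) (m p) (m p) (tensor_1423 t))) \<and>
          bij_betw (\<lambda>v. \<lambda>w\<in>fibre F p. b p (v \<otimes> w)) (fibre F p) (dual_space (fibre F p))))"

text \<open>In the last clause, linearity of \<open>v \<mapsto> b\<^sub>p(v, -)\<close> is automatic, so an isomorphism is a bijection.\<close>

definition polar_form :: "('a::real_vector \<Rightarrow> real) \<Rightarrow> 'a \<Rightarrow> 'a \<Rightarrow> real" where
  "polar_form q x y = q (x + y) - q x - q y"

definition quadratic_form_on :: "'a::real_vector set \<Rightarrow> ('a \<Rightarrow> real) \<Rightarrow> bool" where
  "quadratic_form_on V q \<longleftrightarrow>
     (\<forall>c. \<forall>x\<in>V. q (c *\<^sub>R x) = c\<^sup>2 * q x) \<and> bilinear_on V V (polar_form q)"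

definition octonion_algebra ::
  "'a::real_vector set \<Rightarrow> ('a \<Rightarrow> 'a \<Rightarrow> 'a) \<Rightarrow> 'a \<Rightarrow> ('a \<Rightarrow> real) \<Rightarrow> bool" where
  "octonion_algebra C mul u q \<longleftrightarrow>
     subspace C \<and> dim C = 8 \<and>
     (\<forall>x\<in>C. \<forall>y\<in>C. mul x y \<in> C) \<and> bilinear_on C C mul \<and>
     u \<in> C \<and> (\<forall>x\<in>C. mul u x = x \<and> mul x u = x) \<and>
     quadratic_form_on C q \<and>
     (\<forall>x\<in>C. (\<forall>y\<in>C. polar_form q x y = 0) \<longrightarrow> x = 0) \<and>
     (\<forall>x\<in>C. \<forall>y\<in>C. q (mul x y) = q x * q y)"

end

theory Submission
  imports Defs
begin

text \<open>Every axiom of an octonion algebra object holds fibre by fibre, so the claim is linear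
  algebra in the single space \<open>V = fibre F p\<close>. Morphisms are linear on fibres, hence
  multiplication and \<open>b p\<close> become bilinear on \<open>V\<close>, and each tensor
  identity is read off on pure tensors. A local trivialisation at \<open>p\<close> gives dimension 8
  (\<open>dim_eq_if_linear_bij_betw\<close>). Since \<open>b p\<close> is symmetric, the polar form
  of half its diagonal is \<open>b p\<close> itself (\<open>polar_form_half\<close>), so its
  non-degeneracy is that of the quadratic form. Multiplicativity is the third axiom on (x \<otimes>
  x) \<otimes> (y \<otimes> y): both permutations yield (x \<otimes> y) \<otimes> (x \<otimes> y),
  so b(x,x) b(y,y) = 2 b(xy,xy), and division by 4 gives q(x) q(y) = q(xy).\<close>

lemma subspace_tensor_space: "subspace (tensor_space V W)"
  by (simp add: tensor_space_def)

lemma tensor_in_tensor_space: "x \<in> V \<Longrightarrow> y \<in> W \<Longrightarrow> x \<otimes> y \<in> tensor_space V W"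
  unfolding tensor_space_def by (rule span_base) blast

lemma bilinear_on_tensor_comp:
  assumes "linear_on (tensor_space V W) f"
  shows "bilinear_on V W (\<lambda>x y. f (x \<otimes> y))"
  using assms unfolding bilinear_on_def linear_on_def
  by (simp add: tensor_add tensor_scale tensor_in_tensor_space)

text \<open>\<open>tensor_map\<close> is obtained by choice, so its values on pure tensors must come
  from the bilinearity of (x, y) \<mapsto> f x \<otimes> g y on the two subspaces.\<close>

lemma tensor_map_tensor:
  assumes "subspace V" "subspace W" "linear_on V f" "linear_on W g" "x \<in> V" "y \<in> W"
  shows "tensor_map V W f g (x \<otimes> y) = f x \<otimes> g y"
  unfolding tensor_map_def
  by (rule tensor_lift_tensor)
    (use assms in \<open>simp_all add: bilinear_on_def linear_on_def tensor_add tensor_scale\<close>)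

lemma tensor_lunit_tensor: "tensor_lunit (c \<otimes> x) = c *\<^sub>R x"
  unfolding tensor_lunit_def
  by (rule tensor_lift_tensor) (simp_all add: bilinear_on_def linear_on_def algebra_simps)

lemma tensor_runit_tensor: "tensor_runit (x \<otimes> c) = c *\<^sub>R x"
  unfolding tensor_runit_def
  by (rule tensor_lift_tensor) (simp_all add: bilinear_on_def linear_on_def algebra_simps)

lemma tensor_swap_tensor: "tensor_swap (x \<otimes> y) = y \<otimes> x"
  unfolding tensor_swap_def
  by (rule tensor_lift_tensor)
    (simp_all add: bilinear_on_def linear_on_def tensor_add tensor_scale)

text \<open>The ambient space of \<open>V\<close> may be infinite-dimensional and \<open>f\<close>
  is linear only on \<open>V\<close>. Its inverse, however, is linear on the whole Euclidean space
  and carries the standard basis to a basis of \<open>V\<close>.\<close>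

lemma dim_eq_if_linear_bij_betw:
  fixes f :: "'a::real_vector \<Rightarrow> 'b::euclidean_space"
  assumes V: "subspace V" and f: "linear_on V f" "bij_betw f V UNIV"
  shows "dim V = DIM('b)"
proof -
  define h where "h = inv_into V f"
  have h: "h y \<in> V" "f (h y) = y" for y
    using f(2) by (auto simp: h_def bij_betw_def inv_into_into f_inv_into_f)
  have hf: "h (f x) = x" if "x \<in> V" for x
    using f(2) that by (simp add: h_def bij_betw_def)
  have lin: "linear h"
  proof (rule linearI)
    show "h (x + y) = h x + h y" for x y
      \<comment> \<open>\<open>h x + h y\<close> lies in \<open>V\<close> and \<open>f\<close> sends
        it to \<open>x + y\<close>; applying \<open>h\<close> gives additivity. Scaling is
        analogous.\<close>
      using f(1) h hf[of "h x + h y"] subspace_add[OF V] by (simp add: linear_on_def)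
    show "h (c *\<^sub>R x) = c *\<^sub>R h x" for c x
      using f(1) h hf[of "c *\<^sub>R h x"] subspace_scale[OF V] by (simp add: linear_on_def)
  qed
  have inj: "inj h"
    using h(2) by (rule inj_on_inverseI)
  have "range h = V"
    using h(1) hf by (auto simp: image_iff) metis
  then have "span (h ` Basis) = V"
    by (simp add: linear_span_image[OF lin])
  moreover have "independent (h ` Basis)"
    using linear_independent_injective_image[OF lin independent_Basis inj_on_subset[OF inj]] by simp
  ultimately have "dim V = card (h ` Basis)"
    by (metis dim_span dim_eq_card_independent)
  then show ?thesis
    using card_image[OF inj_on_subset[OF inj]] by simp
qed

text \<open>Expanding the diagonal at x + y leaves the cross terms \<beta> x y + \<beta> y x, equal
  by symmetry; the factor 1/2 removes the doubling.\<close>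

lemma polar_form_half:
  assumes V: "subspace V" and \<beta>: "bilinear_on V V \<beta>"
    and sym: "\<And>x y. x \<in> V \<Longrightarrow> y \<in> V \<Longrightarrow> \<beta> x y = (\<beta> y x :: real)"
    and xy: "x \<in> V" "y \<in> V"
  shows "polar_form (\<lambda>x. \<beta> x x / 2) x y = \<beta> x y"
  using \<beta> xy sym[OF xy] subspace_add[OF V xy]
  by (simp add: polar_form_def bilinear_on_def linear_on_def field_simps)

lemma quadratic_form_on_half:
  assumes V: "subspace V" and \<beta>: "bilinear_on V V \<beta>"
    and sym: "\<And>x y. x \<in> V \<Longrightarrow> y \<in> V \<Longrightarrow> \<beta> x y = (\<beta> y x :: real)"
  shows "quadratic_form_on V (\<lambda>x. \<beta> x x / 2)"
proof -
  note pol = polar_form_half[OF V \<beta> sym]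
  have "\<beta> (c *\<^sub>R x) (c *\<^sub>R x) = c\<^sup>2 * \<beta> x x" if "x \<in> V" for c x
    using \<beta> that subspace_scale[OF V that]
    by (simp add: bilinear_on_def linear_on_def power2_eq_square)
  moreover have "bilinear_on V V (polar_form (\<lambda>x. \<beta> x x / 2))"
    \<comment> \<open>\<open>pol\<close> rewrites the polar form to \<beta> only on
      \<open>V\<close>, so closure of \<open>V\<close> under sums and multiples is supplied.\<close>
    using \<beta> by (simp add: bilinear_on_def linear_on_def pol subspace_add[OF V] subspace_scale[OF V])
  ultimately show ?thesis
    by (simp add: quadratic_form_on_def)
qed

theorem lemma4p13:
  fixes M :: "'m manifold"
    and F :: "('m, 'v::real_vector, 8) vbundle"
    and m :: "'m \<Rightarrow> ('v, 'v) tensor \<Rightarrow> 'v"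
    and e :: "'m \<Rightarrow> real \<Rightarrow> 'v"
    and b :: "'m \<Rightarrow> ('v, 'v) tensor \<Rightarrow> real"
  assumes "smooth_manifold M"
    and "connected_space (mtop M)"
    and "octonion_algebra_object M F m e b"
  shows "\<forall>p\<in>topspace (mtop M).
    octonion_algebra (fibre F p) (\<lambda>x y. m p (x \<otimes> y)) (e p 1) (\<lambda>x. b p (x \<otimes> x) / 2)"
proof
  fix p assume p: "p \<in> topspace (mtop M)"
  define V where "V = fibre F p"
  note obj = assms(3)[unfolded octonion_algebra_object_def Let_def]
  have fib: "fibre (trivial_line_bundle M) p = UNIV"
    "fibre (tensor_bundle F F) p = tensor_space V V"
    "fibre (tensor_bundle (trivial_line_bundle M) F) p = tensor_space UNIV V"
    "fibre (tensor_bundle F (trivial_line_bundle M)) p = tensor_space V UNIV"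
    "fibre (tensor_bundle (tensor_bundle F F) (tensor_bundle F F)) p
      = tensor_space (tensor_space V V) (tensor_space V V)"
    by (simp_all add: tensor_bundle_def trivial_line_bundle_def V_def)
  have F: "smooth_vector_bundle M F"
    and mor: "bundle_morphism M (tensor_bundle F F) F m"
      "bundle_morphism M (trivial_line_bundle M) F e"
      "bundle_morphism M (tensor_bundle F F) (trivial_line_bundle M) b"
    using obj by blast+
  note fibrewise = bspec[OF conjunct2[OF conjunct2[OF conjunct2[OF conjunct2[OF obj]]]] p]
  have unit_l: "\<forall>t\<in>tensor_space UNIV V. m p (tensor_map UNIV V (e p) id t) = tensor_lunit t"
    and unit_r: "\<forall>t\<in>tensor_space V UNIV. m p (tensor_map V UNIV id (e p) t) = tensor_runit t"
    and swap: "\<forall>t\<in>tensor_space V V. b p (tensor_swap t) = b p t"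
    and comp: "\<forall>t\<in>tensor_space (tensor_space V V) (tensor_space V V).
        tensor_lunit (tensor_map (tensor_space V V) (tensor_space V V) (b p) (b p) t) =
          b p (tensor_map (tensor_space V V) (tensor_space V V) (m p) (m p) (tensor_1324 t)) +
          b p (tensor_map (tensor_space V V) (tensor_space V V) (m p) (m p) (tensor_1423 t))"
    and nondeg: "bij_betw (\<lambda>v. \<lambda>w\<in>V. b p (v \<otimes> w)) V (dual_space V)"
    using fibrewise[unfolded fib V_def[symmetric]] by blast+
  have V: "subspace V"
    using F p by (auto simp: smooth_vector_bundle_def V_def)
  have m: "linear_on (tensor_space V V) (m p)" "\<And>t. t \<in> tensor_space V V \<Longrightarrow> m p t \<in> V"
    and e: "linear_on UNIV (e p)" "\<And>c. e p c \<in> V"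
    and b: "linear_on (tensor_space V V) (b p)"
    using mor[unfolded bundle_morphism_def, THEN conjunct1, THEN bspec, OF p]
    by (auto simp: fib V_def[symmetric] Pi_iff)
  \<comment> \<open>A trivialisation over a neighbourhood of \<open>p\<close> identifies the fibre
    with \<open>real ^ 8\<close>.\<close>
  obtain U \<Phi> where "(U, \<Phi>) \<in> trivs F" "p \<in> U"
    using F p unfolding smooth_vector_bundle_def by blast
  then have "linear_on V (\<Phi> p)" "bij_betw (\<Phi> p) V UNIV"
    using F unfolding smooth_vector_bundle_def V_def by blast+
  from dim_eq_if_linear_bij_betw[OF V this] have dim: "dim V = 8"
    by simp
  have id: "linear_on V id"
    by (simp add: linear_on_def)
  have unit: "m p (e p 1 \<otimes> x) = x" "m p (x \<otimes> e p 1) = x" if x: "x \<in> V" for x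
    \<comment> \<open>The canonical isomorphisms send 1 \<otimes> x and x \<otimes> 1 to x.\<close>
    using unit_l[rule_format, of "1 \<otimes> x"] unit_r[rule_format, of "x \<otimes> 1"] x
    by (simp_all add: tensor_in_tensor_space tensor_map_tensor V e(1) id
        tensor_lunit_tensor tensor_runit_tensor)
  have bil: "bilinear_on V V (\<lambda>x y. b p (x \<otimes> y))"
    by (rule bilinear_on_tensor_comp[OF b])
  have sym: "b p (x \<otimes> y) = b p (y \<otimes> x)" if "x \<in> V" "y \<in> V" for x y
    using swap[rule_format, of "y \<otimes> x"] that by (simp add: tensor_in_tensor_space tensor_swap_tensor)
  have pol: "polar_form (\<lambda>x. b p (x \<otimes> x) / 2) x y = b p (x \<otimes> y)" if "x \<in> V" "y \<in> V" for x y
    using polar_form_half[OF V bil sym that] by simp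
  have zero: "x = 0" if x: "x \<in> V" "\<forall>y\<in>V. b p (x \<otimes> y) = 0" for x
  \<comment> \<open>A vector orthogonal to all of \<open>V\<close> induces the same linear form as
    0, so it is 0 by injectivity of the map to the dual.\<close>
  proof (rule inj_onD[OF bij_betw_imp_inj_on[OF nondeg]])
    have "b p (0 \<otimes> y) = 0" if "y \<in> V" for y
      using bil that subspace_0[OF V] unfolding bilinear_on_def linear_on_def
      by (metis scaleR_zero_left)
    with x(2) show "(\<lambda>w\<in>V. b p (x \<otimes> w)) = (\<lambda>w\<in>V. b p (0 \<otimes> w))"
      by (auto simp: restrict_def)
  qed (simp_all add: x subspace_0[OF V])
  have mult: "b p (m p (x \<otimes> y) \<otimes> m p (x \<otimes> y)) / 2 = b p (x \<otimes> x) / 2 * (b p (y \<otimes> y) / 2)"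
    if xy: "x \<in> V" "y \<in> V" for x y
    \<comment> \<open>On this diagonal tensor \<open>tensor_1324\<close> and
      \<open>tensor_1423\<close> agree, so the right-hand side is twice one term.\<close>
    using comp[rule_format, of "(x \<otimes> x) \<otimes> (y \<otimes> y)"] xy
    by (simp add: tensor_in_tensor_space tensor_map_tensor subspace_tensor_space m(1) b
        tensor_lunit_tensor tensor_1324 tensor_1423)
  have "octonion_algebra V (\<lambda>x y. m p (x \<otimes> y)) (e p 1) (\<lambda>x. b p (x \<otimes> x) / 2)"
    unfolding octonion_algebra_def
    using V dim m(2)[OF tensor_in_tensor_space] bilinear_on_tensor_comp[OF m(1)] e(2) unit
      quadratic_form_on_half[OF V bil sym] pol zero mult
    by simp
  then show "octonion_algebra (fibre F p) (\<lambda>x y. m p (x \<otimes> y)) (e p 1) (\<lambda>x. b p (x \<otimes> x) / 2)"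
    by (simp only: V_def)
qed

end
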